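(* Let $S=\{0,1,\dots,12\}$ and $S'=\{0',1',\dots,12'\}$ be disjoint. The following base blocks generate (under addition modulo $13$) a CURD with $\lambda=1$, on the $n=26$ varieties $S\cup S'$, with partition $6^1 2^{10}$: - the block of size $6$: $\{1,3,9,2',5',6'\}$; - blocks within $S$: $\{2,12\},\ \{4,5\},\ \{6,10\}$; - blocks within $S'$: $\{4',11'\},\ \{7',12'\},\ \{8',10'\}$; - blocks between $S$ and $S'$: $\{0,0'\},\ \{7,1'\},\ \{8,3'\},\ \{11,9'\}$.
   Context: For $j\in\{0,\dots,12\}$, adding $j$ to an element of $S\cup S'$ means $i\mapsto i+j \pmod{13}$ on $S$ and $i'\mapsto (i+j \bmod 13)'$ on $S'$. The base blocks generate the design whose parallel classes are indexed by $j=0,1,\dots,12$, the $j$-th parallel class consisting of all base blocks with $j$ added to every element. A pairwise balanced design with index $\lambda$ is a pair $(X,\mathcal B)$ of a finite set $X$ of varieties and a collection $\mathcal B$ of subsets of $X$ (blocks) such that each pair of distinct varieties appears together in exactly $\lambda$ blocks. It is a Class-Uniformly Resolvable Design (CURD) if $\mathcal B$ is partitioned into parallel classes, each of which contains each variety exactly once, and all parallel classes have the same block sizes (with multiplicity). Partition $6^1 2^{10}$ means that each parallel class consists of exactly one block of size $6$ and ten blocks of size $2$. *)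

theory Defs
  imports "HOL-Library.Multiset"
begin

text \<open>
  Collections of blocks are multisets of sets, so that blocks are counted with multiplicity
  (a block occurring twice contributes twice to the index).
\<close>

definition pairwise_balanced_design :: "'a set \<Rightarrow> 'a set multiset \<Rightarrow> nat \<Rightarrow> bool" where
  "pairwise_balanced_design X \<B> lam \<longleftrightarrow>
     finite X \<and>
     (\<forall>b\<in>#\<B>. b \<subseteq> X) \<and>
     (\<forall>x\<in>X. \<forall>y\<in>X. x \<noteq> y \<longrightarrow> size {#b \<in># \<B>. x \<in> b \<and> y \<in> b#} = lam)"

definition parallel_class :: "'a set \<Rightarrow> 'a set multiset \<Rightarrow> bool" where
  "parallel_class X P \<longleftrightarrow>
     (\<forall>b\<in>#P. b \<subseteq> X) \<and> (\<forall>x\<in>X. size {#b \<in># P. x \<in> b#} = 1)"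

text \<open>
  The multiset \<open>\<R>\<close> lists the parallel classes into which the block collection \<open>\<B>\<close> is
  partitioned, each class being itself a multiset of blocks.
\<close>

definition CURD ::
    "'a set \<Rightarrow> 'a set multiset \<Rightarrow> nat \<Rightarrow> 'a set multiset multiset \<Rightarrow> bool" where
  "CURD X \<B> lam \<R> \<longleftrightarrow>
     pairwise_balanced_design X \<B> lam \<and>
     \<B> = \<Sum>\<^sub># \<R> \<and>
     (\<forall>P\<in>#\<R>. parallel_class X P) \<and>
     (\<forall>P\<in>#\<R>. \<forall>Q\<in>#\<R>. image_mset card P = image_mset card Q)"

definition has_partition :: "'a set multiset multiset \<Rightarrow> nat multiset \<Rightarrow> bool" where
  "has_partition \<R> T \<longleftrightarrow> (\<forall>P\<in>#\<R>. image_mset card P = T)"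

text \<open>The variety \<open>i\<close> of \<open>S\<close> is \<open>Inl i\<close>, and the variety \<open>i'\<close> of \<open>S'\<close> is \<open>Inr i\<close>.\<close>

type_synonym variety = "nat + nat"

definition S :: "variety set" where
  "S = Inl ` {0..12}"

definition S' :: "variety set" where
  "S' = Inr ` {0..12}"

definition add13 :: "nat \<Rightarrow> variety \<Rightarrow> variety" where
  "add13 j = map_sum (\<lambda>i. (i + j) mod 13) (\<lambda>i. (i + j) mod 13)"

definition base_blocks :: "variety set multiset" where
  "base_blocks =
     {# {Inl 1, Inl 3, Inl 9, Inr 2, Inr 5, Inr 6},
        {Inl 2, Inl 12}, {Inl 4, Inl 5}, {Inl 6, Inl 10},
        {Inr 4, Inr 11}, {Inr 7, Inr 12}, {Inr 8, Inr 10},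
        {Inl 0, Inr 0}, {Inl 7, Inr 1}, {Inl 8, Inr 3}, {Inl 11, Inr 9} #}"

definition translate_class :: "variety set multiset \<Rightarrow> nat \<Rightarrow> variety set multiset" where
  "translate_class \<A> j = {# add13 j ` b. b \<in># \<A> #}"

definition generated_classes :: "variety set multiset \<Rightarrow> variety set multiset multiset" where
  "generated_classes \<A> = {# translate_class \<A> j. j \<in># mset_set {0..12} #}"

definition generated_blocks :: "variety set multiset \<Rightarrow> variety set multiset" where
  "generated_blocks \<A> = (\<Sum>j\<in>{0..12}. translate_class \<A> j)"

end

theory Submission
  imports Defs
begin

text \<open>
  This is the method of mixed differences. Membership of two varieties in a translated block
  means membership of the two back-translated varieties in the base block, so the number of
  blocks through a pair is invariant under translation. It therefore suffices to count the
  blocks through the pairs whose first member is \<open>0\<close> or \<open>0'\<close>.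
\<close>

text \<open>Moving the window of summation by one replaces the term \<open>f k\<close> by
  \<open>f (n + k)\<close>, and these are equal by periodicity; induction on \<open>k\<close> does
  the rest.\<close>

lemma sum_shift_periodic:
  fixes f :: "nat \<Rightarrow> 'a::comm_monoid_add"
  assumes "\<And>j. f (j + n) = f j"
  shows "(\<Sum>j<n. f (j + k)) = (\<Sum>j<n. f j)"
proof (induction k)
  case (Suc k)
  have "(\<Sum>j<n. f (j + Suc k)) = (\<Sum>j<n. f (j + k))"
  proof (cases n)
    case (Suc m)
    have "f (m + Suc k) = f k"
      using assms[of k] Suc by (simp add: ac_simps)
    then have "(\<Sum>j<Suc m. f (j + Suc k)) = f k + (\<Sum>j<m. f (Suc j + k))"
      by (simp add: add.commute)
    also have "\<dots> = (\<Sum>j<Suc m. f (j + k))"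
      by (simp add: sum.lessThan_Suc_shift del: sum.lessThan_Suc)
    finally show ?thesis
      using Suc by simp
  qed simp
  with Suc.IH show ?case
    by simp
qed simp

lemma add13_Inl [simp]: "add13 j (Inl i) = Inl ((i + j) mod 13)"
  and add13_Inr [simp]: "add13 j (Inr i) = Inr ((i + j) mod 13)"
  by (simp_all add: add13_def)

lemma add13_add13 [simp]: "add13 k (add13 j x) = add13 (j + k) x"
  by (cases x) (simp_all add: mod_simps add.assoc)

lemma add13_period: "add13 (j + 13) x = add13 j x"
  by (cases x) (simp_all flip: add.assoc)

text \<open>The type \<open>variety\<close> contains all natural numbers, and
  \<open>add13 13\<close> reduces them modulo 13, so it is the identity only on reduced
  residues.\<close>

lemma add13_13: "x \<in> S \<union> S' \<Longrightarrow> add13 13 x = x"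
  by (auto simp: S_def S'_def)

lemma add13_closed: "add13 j x \<in> S \<union> S'"
proof -
  have "i mod 13 \<le> 12" for i :: nat
    using mod_less_divisor[of 13 i] by linarith
  then show ?thesis
    by (cases x) (simp_all add: S_def S'_def)
qed

text \<open>On the varieties, adding \<open>13 - j\<close> undoes adding \<open>j\<close>, because
  the two shifts compose to \<open>add13 13\<close>; the bound on \<open>j\<close> keeps the
  subtraction from truncating.\<close>

lemma mem_translate_iff:
  assumes "x \<in> S \<union> S'" "b \<subseteq> S \<union> S'" "j \<le> 13"
  shows "x \<in> add13 j ` b \<longleftrightarrow> add13 (13 - j) x \<in> b"
proof
  assume "x \<in> add13 j ` b"
  then obtain y where y: "y \<in> b" "x = add13 j y"
    by blast
  then show "add13 (13 - j) x \<in> b"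
    using assms add13_13[of y] by auto
next
  assume "add13 (13 - j) x \<in> b"
  then have "add13 j (add13 (13 - j) x) \<in> add13 j ` b"
    by (rule imageI)
  then show "x \<in> add13 j ` b"
    using assms add13_13[of x] by simp
qed

lemma inj_on_add13:
  assumes "j \<le> 13"
  shows "inj_on (add13 j) (S \<union> S')"
  using assms add13_13 by (intro inj_on_inverseI[where g = "add13 (13 - j)"]) simp

lemma lessThan_13: "{..<13} = {0,1,2,3,4,5,6,7,8,9,10,11,12::nat}"
  by (simp add: numeral_eq_Suc lessThan_Suc insert_commute)

text \<open>Explicit enumeration turns a statement about all varieties into 26 closed instances that
  the simplifier can evaluate.\<close>

lemma ball_varieties:
  "(\<forall>x\<in>S \<union> S'. P x) \<longleftrightarrow>
     (\<forall>i\<in>{0,1,2,3,4,5,6,7,8,9,10,11,12}. P (Inl i)) \<and>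
     (\<forall>i\<in>{0,1,2,3,4,5,6,7,8,9,10,11,12}. P (Inr i))"
proof -
  have "{0..12} = {..<13::nat}"
    by auto
  then show ?thesis
    by (simp only: S_def S'_def lessThan_13 ball_Un ball_simps)
qed

lemma base_blocks_subset: "b \<in># base_blocks \<Longrightarrow> b \<subseteq> S \<union> S'"
  by (auto simp: base_blocks_def S_def S'_def)

lemma size_base_blocks_containing: "\<forall>x\<in>S \<union> S'. size {#b \<in># base_blocks. x \<in> b#} = 1"
  by (simp only: ball_varieties ball_simps) (simp add: base_blocks_def)

lemma image_card_base_blocks: "image_mset card base_blocks = {#6#} + replicate_mset 10 2"
  by (simp add: base_blocks_def numeral_eq_Suc)

text \<open>The translation acts on the pair instead of on the blocks, so that evaluation needs only
  membership in the base blocks.\<close>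

definition pair_count :: "variety \<Rightarrow> variety \<Rightarrow> nat" where
  "pair_count x y =
     (\<Sum>j<13. size {#b \<in># base_blocks. add13 j x \<in> b \<and> add13 j y \<in> b#})"

text \<open>Translating the pair by \<open>k\<close> shifts the summation index by \<open>k\<close>,
  and the summand has period 13.\<close>

lemma pair_count_add13: "pair_count (add13 k x) (add13 k y) = pair_count x y"
proof -
  define f where "f j = size {#b \<in># base_blocks. add13 j x \<in> b \<and> add13 j y \<in> b#}" for j
  have "(\<Sum>j<13. f (j + k)) = (\<Sum>j<13. f j)"
    by (rule sum_shift_periodic) (simp add: f_def add13_period)
  then show ?thesis
    by (simp add: pair_count_def f_def add.commute)
qed

text \<open>This is the difference condition, checked by evaluation: the base blocks yield each
  nonzero residue once as a difference within \<open>S\<close>, once within \<open>S'\<close>, and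
  each residue once as a mixed difference.\<close>

lemma pair_count_zero:
  "\<forall>y\<in>S \<union> S'. y \<noteq> Inl 0 \<longrightarrow> pair_count (Inl 0) y = 1"
  "\<forall>y\<in>S \<union> S'. y \<noteq> Inr 0 \<longrightarrow> pair_count (Inr 0) y = 1"
  by (simp_all only: ball_varieties ball_simps)
    (simp_all add: pair_count_def lessThan_13 base_blocks_def)

lemma pair_count_eq_1:
  assumes x: "x \<in> S \<union> S'" and y: "y \<in> S \<union> S'" and "x \<noteq> y"
  shows "pair_count x y = 1"
proof -
  obtain a where a: "a \<le> 12" "x = Inl a \<or> x = Inr a"
    using x by (auto simp: S_def S'_def)
  \<comment> \<open>The shift \<open>13 - a\<close> is the one that carries \<open>x\<close> to
    \<open>Inl 0\<close> or \<open>Inr 0\<close>.\<close>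
  define y' where "y' = add13 (13 - a) y"
  have y': "y' \<in> S \<union> S'"
    unfolding y'_def by (rule add13_closed)
  have "y' \<noteq> add13 (13 - a) x"
    using inj_on_add13[of "13 - a"] assms by (auto simp: y'_def inj_on_eq_iff)
  then have "pair_count (add13 (13 - a) x) y' = 1"
    using a y' pair_count_zero by auto
  then show ?thesis
    by (simp only: y'_def pair_count_add13)
qed

lemma size_translate_class:
  "size {#B \<in># translate_class \<A> j. P B#} = size {#b \<in># \<A>. P (add13 j ` b)#}"
  by (simp add: translate_class_def filter_mset_image_mset)

lemma filter_mset_sum:
  "finite A \<Longrightarrow> filter_mset P (\<Sum>j\<in>A. f j) = (\<Sum>j\<in>A. filter_mset P (f j))"
  by (induction A rule: finite_induct) simp_all

lemma size_generated_blocks: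
  assumes x: "x \<in> S \<union> S'" and y: "y \<in> S \<union> S'"
  shows "size {#B \<in># generated_blocks base_blocks. x \<in> B \<and> y \<in> B#} = pair_count x y"
proof -
  define f where "f j = size {#b \<in># base_blocks. add13 j x \<in> b \<and> add13 j y \<in> b#}" for j
  have 13: "{0..12} = {..<13::nat}"
    by auto
  have "size {#b \<in># base_blocks. x \<in> add13 j ` b \<and> y \<in> add13 j ` b#} = f (13 - j)"
    if "j < 13" for j
    using that x y mem_translate_iff base_blocks_subset unfolding f_def
    by (intro arg_cong[of _ _ size] filter_mset_cong) auto
  then have "size {#B \<in># generated_blocks base_blocks. x \<in> B \<and> y \<in> B#} = (\<Sum>j<13. f (13 - j))"
    by (simp add: generated_blocks_def filter_mset_sum size_translate_class 13)
  \<comment> \<open>The argument \<open>13 - j\<close> runs through 13, ..., 1 rather than 0, ...,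
    12. Reversing the order by \<open>12 - j\<close> leaves a shift by one, which periodicity
    removes.\<close>
  also have "\<dots> = (\<Sum>j<13. f (j + 1))"
    by (rule sum.reindex_bij_witness[of _ "\<lambda>j. 12 - j" "\<lambda>j. 12 - j"])
      (auto intro!: arg_cong[of _ _ f])
  also have "\<dots> = (\<Sum>j<13. f j)"
    by (rule sum_shift_periodic) (simp add: f_def add13_period)
  finally show ?thesis
    by (simp add: pair_count_def f_def)
qed

text \<open>The base blocks cover each variety exactly once, so in a translated class the only block
  through \<open>x\<close> comes from the base block through the back-translate of
  \<open>x\<close>.\<close>

lemma parallel_class_translate:
  assumes "j \<le> 12"
  shows "parallel_class (S \<union> S') (translate_class base_blocks j)"
  unfolding parallel_class_def
proof (intro conjI ballI)
  fix B assume "B \<in># translate_class base_blocks j"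
  then show "B \<subseteq> S \<union> S'"
    using add13_closed by (auto simp: translate_class_def)
next
  fix x assume x: "x \<in> S \<union> S'"
  have "{#b \<in># base_blocks. x \<in> add13 j ` b#} = {#b \<in># base_blocks. add13 (13 - j) x \<in> b#}"
    using assms x mem_translate_iff base_blocks_subset by (intro filter_mset_cong) auto
  then show "size {#B \<in># translate_class base_blocks j. x \<in> B#} = 1"
    using size_base_blocks_containing add13_closed by (simp add: size_translate_class)
qed

lemma image_card_translate_class:
  assumes "j \<le> 12"
  shows "image_mset card (translate_class base_blocks j) = {#6#} + replicate_mset 10 2"
proof -
  \<comment> \<open>Injectivity of \<open>add13 j\<close> holds on the varieties only, hence the
    appeal to \<open>base_blocks_subset\<close>.\<close>
  have "card (add13 j ` b) = card b" if "b \<in># base_blocks" for b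
    using assms inj_on_subset[OF inj_on_add13 base_blocks_subset[OF that]]
    by (intro card_image) auto
  then have "image_mset card (translate_class base_blocks j) = image_mset card base_blocks"
    by (auto simp: translate_class_def multiset.map_comp intro: image_mset_cong)
  then show ?thesis
    by (simp only: image_card_base_blocks)
qed

lemma generated_blocks_eq: "generated_blocks \<A> = \<Sum>\<^sub># (generated_classes \<A>)"
  by (simp add: generated_blocks_def generated_classes_def sum_unfold_sum_mset)

lemma pairwise_balanced_design_generated_blocks:
  "pairwise_balanced_design (S \<union> S') (generated_blocks base_blocks) 1"
  unfolding pairwise_balanced_design_def
proof (intro conjI ballI impI)
  show "finite (S \<union> S')"
    by (simp add: S_def S'_def)
  fix B assume "B \<in># generated_blocks base_blocks"
  then obtain j where "j \<le> 12" "B \<in># translate_class base_blocks j"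
    by (auto simp: generated_blocks_eq generated_classes_def)
  then show "B \<subseteq> S \<union> S'"
    using parallel_class_translate[of j] unfolding parallel_class_def by blast
next
  fix x y assume "x \<in> S \<union> S'" "y \<in> S \<union> S'" "x \<noteq> y"
  then show "size {#B \<in># generated_blocks base_blocks. x \<in> B \<and> y \<in> B#} = 1"
    by (simp add: size_generated_blocks pair_count_eq_1)
qed

theorem proposition3p4:
  shows "S \<inter> S' = {} \<and>
    card (S \<union> S') = 26 \<and>
    CURD (S \<union> S') (generated_blocks base_blocks) 1 (generated_classes base_blocks) \<and>
    has_partition (generated_classes base_blocks) ({#6#} + replicate_mset 10 2)"
proof (intro conjI)
  show disjoint: "S \<inter> S' = {}"
    by (auto simp: S_def S'_def)
  have "card S = 13" "card S' = 13"
    by (simp_all add: S_def S'_def card_image)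
  then show "card (S \<union> S') = 26"
    using disjoint by (simp add: card_Un_disjoint S_def S'_def)
  \<comment> \<open>Proved before the \<open>CURD\<close> property, since a common explicit list of
    block sizes also gives the uniformity of the classes.\<close>
  show part: "has_partition (generated_classes base_blocks) ({#6#} + replicate_mset 10 2)"
    using image_card_translate_class by (auto simp: has_partition_def generated_classes_def)
  show "CURD (S \<union> S') (generated_blocks base_blocks) 1 (generated_classes base_blocks)"
    unfolding CURD_def
  proof (intro conjI)
    show "\<forall>P\<in>#generated_classes base_blocks. parallel_class (S \<union> S') P"
      using parallel_class_translate by (auto simp: generated_classes_def)
    show "\<forall>P\<in>#generated_classes base_blocks. \<forall>Q\<in>#generated_classes base_blocks.
        image_mset card P = image_mset card Q"
      using part by (simp add: has_partition_def)
  qed (fact pairwise_balanced_design_generated_blocks generated_blocks_eq)+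
qed

end
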